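(* Let $(X,\mathcal F)$ be a (finite) hypergraph with maximum degree $\Delta$, and let $f$ be a positive integer. Let $\tau_f$ denote the $f$-fold transversal number and $\tau^{\ast}$ the fractional transversal number of $(X,\mathcal F)$. Then $$\tau_f\leq 3.153\,\tau^{\ast}\max\{\ln \Delta, f\}.$$
   Context: A hypergraph is a pair $(X,\mathcal F)$, where $X$ is a finite set (the vertices) and $\mathcal F\subseteq 2^X$ is a family of subsets of $X$ (the edges). It is tacitly assumed that $\mathcal F$ is nonempty and that every edge is nonempty. The maximum degree $\Delta$ is the maximum number of edges a vertex is contained in. An $f$-fold transversal of $(X,\mathcal F)$ is a multiset $A$ of elements of $X$ such that each $F\in\mathcal F$ contains at least $f$ elements of $A$, counted with multiplicity. The $f$-fold transversal number $\tau_f$ is the minimum cardinality (with multiplicity) of an $f$-fold transversal. A fractional transversal is a function $w:X\to[0,1]$ with $\sum_{x\in F}w(x)\ge 1$ for all $F\in\mathcal F$; the fractional transversal number is $\tau^{\ast}=\inf\{\sum_{x\in X}w(x) : w \text{ is a fractional transversal}\}$. *)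

theory Defs
  imports Complex_Main "HOL-Library.Multiset"
begin

text \<open>Edges form a set of subsets, so there are no repeated edges.\<close>

definition hypergraph :: "'a set \<Rightarrow> 'a set set \<Rightarrow> bool" where
  "hypergraph X \<F> \<longleftrightarrow> finite X \<and> \<F> \<subseteq> Pow X \<and> \<F> \<noteq> {} \<and> {} \<notin> \<F>"

definition degree :: "'a set set \<Rightarrow> 'a \<Rightarrow> nat" where
  "degree \<F> x = card {F \<in> \<F>. x \<in> F}"

text \<open>For a hypergraph in the above sense the vertex set is nonempty, so the maximum exists.\<close>

definition max_degree :: "'a set \<Rightarrow> 'a set set \<Rightarrow> nat" where
  "max_degree X \<F> = Max (degree \<F> ` X)"

definition fold_transversal :: "nat \<Rightarrow> 'a set \<Rightarrow> 'a set set \<Rightarrow> 'a multiset \<Rightarrow> bool" where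
  "fold_transversal f X \<F> A \<longleftrightarrow>
     set_mset A \<subseteq> X \<and> (\<forall>F\<in>\<F>. f \<le> size (filter_mset (\<lambda>x. x \<in> F) A))"

text \<open>The minimum exists for a hypergraph: taking every vertex \<open>f\<close> times is an
  \<open>f\<close>-fold transversal, because every edge is nonempty.\<close>

definition fold_transversal_number :: "nat \<Rightarrow> 'a set \<Rightarrow> 'a set set \<Rightarrow> nat" where
  "fold_transversal_number f X \<F> = (LEAST n. \<exists>A. fold_transversal f X \<F> A \<and> size A = n)"

text \<open>Weight functions are total; only their values on \<open>X\<close> matter.\<close>

definition fractional_transversal :: "'a set \<Rightarrow> 'a set set \<Rightarrow> ('a \<Rightarrow> real) \<Rightarrow> bool" where
  "fractional_transversal X \<F> w \<longleftrightarrow>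
     (\<forall>x\<in>X. w x \<in> {0..1}) \<and> (\<forall>F\<in>\<F>. 1 \<le> (\<Sum>x\<in>F. w x))"

definition fractional_transversal_number :: "'a set \<Rightarrow> 'a set set \<Rightarrow> real" where
  "fractional_transversal_number X \<F> =
     Inf {(\<Sum>x\<in>X. w x) | w. fractional_transversal X \<F> w}"

end

(* Scale a fractional transversal w by lambda and round every lambda * w x to one of its two
   neighbouring integers a x, keeping the expectation. Each edge F then still lacks
   (f - a(F))^+ <= 3^(f-1) * 3^(-a(F)) elements, which are added afterwards. Since a(F) has a
   moment generating function below that of a Poisson variable of mean lambda * w(F), the total
   is on average at most lambda * tau + |F| * 3^(f-1) * exp(-2 lambda / 3), where
   |F| <= Delta * tau by double counting. Choosing lambda = 3/2 * (L + (f-1) * ln 3) with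
   L = max (ln Delta) f makes the second summand at most tau, and 3/2 * (1 + ln 3) < 3.153.
   The rounding is derandomised by conditional expectations, one vertex at a time. *)

theory Submission
  imports Defs
begin

text \<open>Rounding \<open>z\<close> at random to \<open>m\<close> or \<open>Suc m\<close> with
  mean \<open>z\<close> makes the expected left-hand side at most the bound, so one of the two
  outcomes achieves it.\<close>

lemma exists_rounding:
  fixes z A t :: real
  assumes z: "0 \<le> z" and A: "0 \<le> A" and t: "0 \<le> t" "t \<le> 1"
  shows "\<exists>n::nat. real n + A * t ^ n \<le> z + A * exp (- ((1 - t) * z))"
proof -
  define m where "m = nat \<lfloor>z\<rfloor>"
  define q where "q = z - real m"
  have q: "0 \<le> q" "q \<le> 1" using z unfolding q_def m_def by linarith+
  \<comment> \<open>Used with \<open>r = 1\<close> for each of the \<open>m\<close> unit steps and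
    with \<open>r = q\<close> for the fractional part; the exponents add up to the one for
    \<open>z\<close>.\<close>
  have one_step: "1 - (1 - t) * r \<le> exp (- ((1 - t) * r))" for r :: real
    using exp_ge_add_one_self[of "- ((1 - t) * r)"] by simp
  have "t ^ m \<le> exp (- (1 - t)) ^ m"
    using one_step[of 1] t by (intro power_mono) auto
  also have "\<dots> = exp (- ((1 - t) * real m))"
    by (simp add: exp_of_nat_mult[symmetric] algebra_simps)
  finally have tm: "t ^ m \<le> exp (- ((1 - t) * real m))" .
  have q': "0 \<le> 1 - (1 - t) * q"
    using mult_le_one[of "1 - t" q] q t by simp
  have "t ^ m * (1 - (1 - t) * q) \<le> exp (- ((1 - t) * real m)) * exp (- ((1 - t) * q))"
    using tm one_step[of q] q' t by (intro mult_mono) auto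
  also have "\<dots> = exp (- ((1 - t) * z))"
    unfolding exp_add[symmetric] q_def by (simp add: algebra_simps)
  finally have bound: "A * (t ^ m * (1 - (1 - t) * q)) \<le> A * exp (- ((1 - t) * z))"
    using A by (intro mult_left_mono)
  \<comment> \<open>The expectation when \<open>q\<close> is the probability of rounding up.\<close>
  have average: "(1 - q) * (real m + A * t ^ m) + q * (real (Suc m) + A * t ^ Suc m)
      = z + A * (t ^ m * (1 - (1 - t) * q))"
    unfolding q_def by (simp add: algebra_simps)
  let ?R = "z + A * exp (- ((1 - t) * z))"
  show ?thesis
  proof (rule ccontr)
    assume "\<not> ?thesis"
    then have gt: "?R < real n + A * t ^ n" for n :: nat
      by (meson not_le)
    have "(1 - q) * ?R + q * ?R
        < (1 - q) * (real m + A * t ^ m) + q * (real (Suc m) + A * t ^ Suc m)"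
    \<comment> \<open>The strict inequality must come from an outcome of positive probability:
      rounding down if \<open>q = 0\<close>, rounding up otherwise.\<close>
    proof (cases "q = 0")
      case True
      then show ?thesis using gt[of m] by simp
    next
      case False
      then show ?thesis
        using q less_imp_le[OF gt[of m]] gt[of "Suc m"]
        by (intro add_le_less_mono[OF mult_left_mono mult_strict_left_mono]) auto
    qed
    also have "\<dots> \<le> ?R" using average bound by linarith
    finally show False by (simp add: algebra_simps)
  qed
qed

text \<open>Conditional expectations: the exponential of an edge bounds the expected factor of its
  vertices still open. The coefficients \<open>k\<close> vary in the induction so that they can
  store the powers of \<open>t\<close> already fixed.\<close>

lemma exists_rounding_exp_potential:
  fixes z :: "'a \<Rightarrow> real" and k :: "'a set \<Rightarrow> real" and t :: real
  assumes "finite X" "finite \<F>" and "\<And>x. x \<in> X \<Longrightarrow> 0 \<le> z x"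
    and "\<And>F. F \<in> \<F> \<Longrightarrow> 0 \<le> k F" and t: "0 \<le> t" "t \<le> 1"
  shows "\<exists>a :: 'a \<Rightarrow> nat. real (sum a X) + (\<Sum>F\<in>\<F>. k F * t ^ sum a (X \<inter> F))
           \<le> sum z X + (\<Sum>F\<in>\<F>. k F * exp (- ((1 - t) * sum z (X \<inter> F))))"
  using assms(1,3,4)
proof (induction X arbitrary: k rule: finite_induct)
  case empty
  then show ?case by simp
next
  case (insert x X)
  \<comment> \<open>Only the edges in \<open>?G\<close> feel the value at \<open>x\<close>, so their
    estimates merge into a single coefficient \<open>A\<close> for
    \<open>exists_rounding\<close>.\<close>
  define e where "e F = k F * exp (- ((1 - t) * sum z (X \<inter> F)))" for F
  let ?G = "{F \<in> \<F>. x \<in> F}" and ?H = "{F \<in> \<F>. x \<notin> F}"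
  have split: "(\<Sum>F\<in>\<F>. g F) = (\<Sum>F\<in>?G. g F) + (\<Sum>F\<in>?H. g F)" for g :: "'a set \<Rightarrow> real"
  proof -
    have "\<F> = ?G \<union> ?H" by blast
    moreover have "sum g (?G \<union> ?H) = sum g ?G + sum g ?H"
      using assms(2) by (intro sum.union_disjoint) auto
    ultimately show ?thesis by simp
  qed
  have "0 \<le> sum e ?G" using insert.prems by (auto simp: e_def intro!: sum_nonneg)
  then obtain n :: nat where n: "real n + sum e ?G * t ^ n
      \<le> z x + sum e ?G * exp (- ((1 - t) * z x))"
    using exists_rounding[of "z x" "sum e ?G" t] insert.prems(1)[of x] t by auto
  define k' where "k' F = k F * (if x \<in> F then t ^ n else 1)" for F
  obtain a :: "'a \<Rightarrow> nat" where a: "real (sum a X) + (\<Sum>F\<in>\<F>. k' F * t ^ sum a (X \<inter> F))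
      \<le> sum z X + (\<Sum>F\<in>\<F>. k' F * exp (- ((1 - t) * sum z (X \<inter> F))))"
    using insert.IH[of k'] insert.prems t by (auto simp: k'_def)
  let ?b = "a(x := n)"
  have b: "sum ?b Y = sum a Y" if "Y \<subseteq> X" for Y
    using that insert.hyps by (intro sum.cong) auto
  have "sum ?b (insert x X \<inter> F) = (if x \<in> F then n else 0) + sum a (X \<inter> F)" for F
    using insert.hyps b[of "X \<inter> F"] by (simp add: Int_insert_left)
  then have "(\<Sum>F\<in>\<F>. k F * t ^ sum ?b (insert x X \<inter> F))
      = (\<Sum>F\<in>\<F>. k' F * t ^ sum a (X \<inter> F))"
    by (intro sum.cong) (auto simp: k'_def power_add)
  moreover have "real (sum ?b (insert x X)) = real n + real (sum a X)"
    using insert.hyps b[of X] by simp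
  moreover have "(\<Sum>F\<in>\<F>. k' F * exp (- ((1 - t) * sum z (X \<inter> F))))
      = sum e ?G * t ^ n + sum e ?H"
    unfolding split sum_distrib_right
    by (intro arg_cong2[where f = "(+)"] sum.cong) (auto simp: k'_def e_def)
  moreover have "(\<Sum>F\<in>\<F>. k F * exp (- ((1 - t) * sum z (insert x X \<inter> F))))
      = sum e ?G * exp (- ((1 - t) * z x)) + sum e ?H"
    unfolding split sum_distrib_right using insert.hyps
    by (intro arg_cong2[where f = "(+)"] sum.cong)
       (auto simp: e_def Int_insert_left exp_add[symmetric] algebra_simps)
  moreover have "sum z (insert x X) = z x + sum z X"
    using insert.hyps by simp
  ultimately show ?case using a n by (intro exI[of _ ?b]) linarith
qed

lemma size_filter_replicate_mset:
  "size (filter_mset P (replicate_mset n x)) = (if P x then n else 0)"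
  by (induction n) auto

lemma size_filter_sum_replicate_mset:
  assumes "finite X"
  shows "size (filter_mset P (\<Sum>x\<in>X. replicate_mset (a x) x)) = sum a {x \<in> X. P x}"
proof -
  have "size (filter_mset P (\<Sum>x\<in>X. replicate_mset (a x) x)) = (\<Sum>x\<in>X. if P x then a x else 0)"
    using assms by (induction X rule: finite_induct) (auto simp: size_filter_replicate_mset)
  then show ?thesis using assms by (simp add: sum.inter_filter)
qed

text \<open>Taking each \<open>x\<close> with multiplicity \<open>a x\<close> leaves an edge
  \<open>F\<close> short of \<open>f - sum a F\<close> elements, which truncated subtraction makes 0
  for a satisfied edge. Copies of one chosen vertex of \<open>F\<close> fill the gap.\<close>

lemma fold_transversal_number_le:
  assumes H: "hypergraph X \<F>"
  shows "fold_transversal_number f X \<F> \<le> sum a X + (\<Sum>F\<in>\<F>. f - sum a F)"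
proof -
  have fin: "finite X" "finite \<F>" and sub: "\<And>F. F \<in> \<F> \<Longrightarrow> F \<subseteq> X"
    using H finite_subset[of \<F> "Pow X"] by (auto simp: hypergraph_def)
  have "\<exists>c. \<forall>F\<in>\<F>. c F \<in> F"
    using H by (intro bchoice) (auto simp: hypergraph_def)
  then obtain c where c: "\<And>F. F \<in> \<F> \<Longrightarrow> c F \<in> F" by blast
  define A where "A = (\<Sum>x\<in>X. replicate_mset (a x) x)"
  define B where "B = (\<Sum>F\<in>\<F>. replicate_mset (f - sum a F) (c F))"
  have size: "size (A + B) = sum a X + (\<Sum>F\<in>\<F>. f - sum a F)"
    unfolding A_def B_def by (simp add: size_multiset_sum)
  have "f \<le> size (filter_mset (\<lambda>x. x \<in> F) (A + B))" if F: "F \<in> \<F>" for F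
  proof -
    have "{x \<in> X. x \<in> F} = F" using sub[OF F] by auto
    then have "size (filter_mset (\<lambda>x. x \<in> F) A) = sum a F"
      unfolding A_def using size_filter_sum_replicate_mset[OF fin(1), of "\<lambda>x. x \<in> F" a] by simp
    \<comment> \<open>Copies added for other edges can only help \<open>F\<close>, so its own share
      of \<open>B\<close> suffices.\<close>
    moreover have "replicate_mset (f - sum a F) (c F) \<subseteq># B"
      unfolding B_def sum.remove[OF fin(2) F] by simp
    then have "size (filter_mset (\<lambda>x. x \<in> F) (replicate_mset (f - sum a F) (c F)))
        \<le> size (filter_mset (\<lambda>x. x \<in> F) B)"
      by (intro size_mset_mono multiset_filter_mono)
    ultimately show ?thesis using c[OF F] by (simp add: size_filter_replicate_mset)
  qed
  moreover have "set_mset (A + B) \<subseteq> X"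
    unfolding A_def B_def using fin c sub
    by (fastforce simp: set_mset_sum split: if_splits)
  ultimately have "fold_transversal f X \<F> (A + B)"
    by (simp add: fold_transversal_def)
  then show ?thesis
    unfolding fold_transversal_number_def using size by (intro Least_le) blast
qed

text \<open>Weighted double counting: every edge has weight at least 1, and summing over all edges
  counts \<open>w x\<close> once per edge through \<open>x\<close>.\<close>

lemma card_edges_le_max_degree_mult:
  assumes H: "hypergraph X \<F>" and w: "fractional_transversal X \<F> w"
  shows "real (card \<F>) \<le> real (max_degree X \<F>) * sum w X"
proof -
  have fin: "finite X" "finite \<F>" and sub: "\<And>F. F \<in> \<F> \<Longrightarrow> F \<subseteq> X"
    using H finite_subset[of \<F> "Pow X"] by (auto simp: hypergraph_def)
  have "real (card \<F>) \<le> (\<Sum>F\<in>\<F>. sum w F)"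
    using w sum_mono[of \<F> "\<lambda>_. 1" "sum w"] by (simp add: fractional_transversal_def)
  also have "\<dots> = (\<Sum>F\<in>\<F>. \<Sum>x | x \<in> X \<and> x \<in> F. w x)"
    using sub by (intro sum.cong) auto
  also have "\<dots> = (\<Sum>x\<in>X. \<Sum>F | F \<in> \<F> \<and> x \<in> F. w x)"
    by (rule sum.swap_restrict[OF fin(2,1)])
  also have "\<dots> = (\<Sum>x\<in>X. real (degree \<F> x) * w x)"
    by (simp add: degree_def)
  also have "\<dots> \<le> (\<Sum>x\<in>X. real (max_degree X \<F>) * w x)"
    using w fin by (intro sum_mono mult_right_mono)
      (auto simp: max_degree_def fractional_transversal_def)
  finally show ?thesis by (simp add: sum_distrib_left)
qed

text \<open>A positive shortfall is \<open>Suc u\<close> with \<open>u = f - 1 - n\<close>, and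
  \<open>Suc u \<le> 3 ^ u\<close>. The exponential form fits the rounding lemma with
  \<open>t = 1 / 3\<close>.\<close>

lemma diff_le_power_three: "real (f - n) \<le> 3 ^ (f - 1) * (1 / 3) ^ n"
proof (cases "f \<le> n")
  case False
  then obtain u where u: "f = Suc (n + u)" by (metis less_iff_Suc_add not_le)
  have "Suc u \<le> 3 ^ u" by (induction u) auto
  then have "real (Suc u) \<le> 3 ^ u"
    by (metis of_nat_le_iff of_nat_numeral of_nat_power)
  then show ?thesis using u by (simp add: power_add power_one_over)
qed simp

text \<open>The upper bound produces the final constant: 3/2 * (1 + 1.102) = 3.153.\<close>

lemma ln_3_bounds: "2 / 3 \<le> ln (3 :: real)" "ln (3 :: real) \<le> 1.102"
proof -
  have "2 / 3 \<le> - ln (1 / 3 :: real)" using ln_le_minus_one[of "1 / 3 :: real"] by simp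
  then show "2 / 3 \<le> ln (3 :: real)" by (simp add: ln_div)
  \<comment> \<open>All Taylor terms are nonnegative, and the first seven already reach 3.\<close>
  have "(\<Sum>n<7. inverse (fact n) *\<^sub>R (1.102 :: real) ^ n) \<le> exp 1.102"
    using summable_exp_generic[of "1.102 :: real"] unfolding exp_def
    by (intro sum_le_suminf) auto
  then have "3 \<le> exp (1.102 :: real)"
    by (simp add: fact_numeral numeral_eq_Suc lessThan_Suc)
  then show "ln (3 :: real) \<le> 1.102"
    by (metis ln_exp ln_le_cancel_iff exp_gt_zero zero_less_numeral)
qed

text \<open>Bounding against every fractional transversal lets the infimum be taken afterwards,
  without asking for an optimal one.\<close>

lemma fold_transversal_number_le_weight:
  assumes H: "hypergraph X \<F>" and f: "f \<ge> 1" and w: "fractional_transversal X \<F> w"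
  shows "real (fold_transversal_number f X \<F>)
           \<le> 3.153 * max (ln (real (max_degree X \<F>))) (real f) * sum w X"
proof -
  define L where "L = max (ln (real (max_degree X \<F>))) (real f)"
  \<comment> \<open>Chosen so that \<open>K * exp (- (2 / 3 * l)) = exp (- L)\<close>: the factor
    \<open>K\<close> of the shortfall bound cancels, and \<open>exp (- L)\<close> offsets the
    maximum degree in the edge count.\<close>
  define l where "l = 3 / 2 * (L + real (f - 1) * ln 3)"
  define K :: real where "K = 3 ^ (f - 1)"
  have fin: "finite X" "finite \<F>" and sub: "\<And>F. F \<in> \<F> \<Longrightarrow> F \<subseteq> X"
    using H finite_subset[of \<F> "Pow X"] by (auto simp: hypergraph_def)
  have L: "real f \<le> L" by (simp add: L_def)
  have l: "0 \<le> l" using L f by (simp add: l_def)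
  have w0: "0 \<le> w x" if "x \<in> X" for x
    using w that by (simp add: fractional_transversal_def)
  have W: "0 \<le> sum w X" using w0 by (intro sum_nonneg)
  have degree_le: "real (max_degree X \<F>) \<le> exp L"
  \<comment> \<open>Degree 0 is split off because \<open>exp (ln d) = d\<close> requires a positive
    \<open>d\<close>.\<close>
  proof (cases "max_degree X \<F> = 0")
    case False
    then have "real (max_degree X \<F>) = exp (ln (real (max_degree X \<F>)))" by simp
    also have "\<dots> \<le> exp L" by (simp add: L_def)
    finally show ?thesis .
  qed simp
  obtain a :: "'a \<Rightarrow> nat" where a: "real (sum a X) + (\<Sum>F\<in>\<F>. K * (1 / 3) ^ sum a (X \<inter> F))
      \<le> (\<Sum>x\<in>X. l * w x) + (\<Sum>F\<in>\<F>. K * exp (- ((1 - 1 / 3) * (\<Sum>x\<in>X \<inter> F. l * w x))))"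
    using exists_rounding_exp_potential[of X \<F> "\<lambda>x. l * w x" "\<lambda>_. K" "1 / 3"] fin w0 l
    by (auto simp: K_def)
  have Int: "X \<inter> F = F" if "F \<in> \<F>" for F using sub[OF that] by auto
  have expl: "K * exp (- (2 / 3 * l)) = exp (- L)"
  proof -
    have "K = exp (real (f - 1) * ln 3)" by (simp add: K_def exp_of_nat_mult)
    then show ?thesis by (simp add: l_def exp_add[symmetric] algebra_simps)
  qed
  have edge: "K * exp (- ((1 - 1 / 3) * (\<Sum>x\<in>X \<inter> F. l * w x))) \<le> exp (- L)"
    if F: "F \<in> \<F>" for F
  proof -
    have "l * 1 \<le> l * sum w F"
      using w F l by (intro mult_left_mono) (auto simp: fractional_transversal_def)
    then have "l \<le> (\<Sum>x\<in>X \<inter> F. l * w x)" by (simp add: Int[OF F] sum_distrib_left)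
    then have "K * exp (- ((1 - 1 / 3) * (\<Sum>x\<in>X \<inter> F. l * w x))) \<le> K * exp (- (2 / 3 * l))"
      by (intro mult_left_mono) (auto simp: K_def)
    with expl show ?thesis by simp
  qed
  have "real (card \<F>) * exp (- L) \<le> (exp L * sum w X) * exp (- L)"
    using card_edges_le_max_degree_mult[OF H w] mult_right_mono[OF degree_le W]
    by (intro mult_right_mono) auto
  also have "\<dots> = sum w X" by (simp add: exp_minus)
  finally have edges: "real (card \<F>) * exp (- L) \<le> sum w X" .
  have "real (fold_transversal_number f X \<F>) \<le> real (sum a X + (\<Sum>F\<in>\<F>. f - sum a F))"
    using fold_transversal_number_le[OF H] of_nat_le_iff by blast
  also have "\<dots> = real (sum a X) + (\<Sum>F\<in>\<F>. real (f - sum a F))" by simp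
  also have "\<dots> \<le> real (sum a X) + (\<Sum>F\<in>\<F>. K * (1 / 3) ^ sum a (X \<inter> F))"
    unfolding K_def using Int diff_le_power_three
    by (intro add_left_mono sum_mono) metis
  also have "\<dots> \<le> l * sum w X + (\<Sum>F\<in>\<F>. exp (- L))"
    using a sum_mono[of \<F>, OF edge, of "\<lambda>F. F"] unfolding sum_distrib_left[of l w X] by linarith
  also have "\<dots> \<le> (l + 1) * sum w X" using edges by (simp add: algebra_simps)
  also have "\<dots> \<le> (3.153 * L) * sum w X"
  proof (intro mult_right_mono W)
    have "real f * ln 3 \<le> L * 1.102"
      using L ln_3_bounds by (intro mult_mono) auto
    \<comment> \<open>Having \<open>f - 1\<close> rather than \<open>f\<close> in \<open>l\<close>
      leaves -3/2 * ln 3, which is at most -1 and absorbs the 1 contributed by the added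
      elements.\<close>
    moreover have "l = 3 / 2 * L + 3 / 2 * (real f * ln 3) - 3 / 2 * ln 3"
      using f by (simp add: l_def of_nat_diff algebra_simps)
    ultimately show "l + 1 \<le> 3.153 * L" using ln_3_bounds(1) by simp
  qed
  finally show ?thesis by (simp add: L_def)
qed

theorem corollary1p2:
  fixes X :: "'a set" and \<F> :: "'a set set" and f :: nat
  assumes "hypergraph X \<F>" and "f \<ge> 1"
  shows "real (fold_transversal_number f X \<F>)
           \<le> 3.153 * fractional_transversal_number X \<F> * max (ln (real (max_degree X \<F>))) (real f)"
proof -
  define C where "C = 3.153 * max (ln (real (max_degree X \<F>))) (real f)"
  have C: "0 < C" using assms(2) by (simp add: C_def less_max_iff_disj)
  \<comment> \<open>The constant weight 1 shows that the infimum ranges over a nonempty set; the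
    bound for each \<open>w\<close>, divided by \<open>C\<close>, is then a lower bound of that
    set.\<close>
  have "1 \<le> card F" if "F \<in> \<F>" for F
    using assms(1) that finite_subset[of F X] by (auto simp: hypergraph_def Suc_le_eq card_gt_0_iff)
  then have "fractional_transversal X \<F> (\<lambda>_. 1)"
    by (fastforce simp: fractional_transversal_def)
  then have "{(\<Sum>x\<in>X. w x) | w. fractional_transversal X \<F> w} \<noteq> {}" by blast
  moreover have "real (fold_transversal_number f X \<F>) / C \<le> W"
    if "W \<in> {(\<Sum>x\<in>X. w x) | w. fractional_transversal X \<F> w}" for W
    using that fold_transversal_number_le_weight[OF assms] C
    by (auto simp: C_def pos_divide_le_eq mult.commute)
  ultimately have "real (fold_transversal_number f X \<F>) / C \<le> fractional_transversal_number X \<F>"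
    unfolding fractional_transversal_number_def by (rule cInf_greatest)
  with C show ?thesis by (simp add: pos_divide_le_eq C_def mult_ac)
qed

end
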